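(* For any real numbers $\alpha\ge1$ and $1\le k<\ell$, \[ \lambda_{k,\alpha k}\le\lambda_{\ell,\alpha\ell}, \] where $\lambda_{k,n}$ denotes the first radial $(k,n)$-eigenvalue.
   Context: For real $0\le k\le n$, $\binom{n}{k}:=\frac{\Gamma(n+1)}{\Gamma(k+1)\Gamma(n-k+1)}$. For $\alpha\ge 1$, a function $u\in C^2(0,1)$ is called $\alpha$-convex if $\limsup_{r\to0}\frac{u'}{r}<\infty$, $u'\ge0$ and $u''+(\alpha-1)\frac{u'}{r}\ge0$ on $(0,1)$. For real $1\le k\le n$, set $\alpha=n/k$ and $S_{k,n}(u):=\binom{n-1}{k-1}\left(\frac{u'}{r}\right)^{k-1}\left(u''+\frac{n-k}{k}\frac{u'}{r}\right)$. An $\alpha$-convex function $u$ and a number $\lambda>0$ solve the radial $(k,n)$-eigenvalue problem if $S_{k,n}(u)=(-\lambda u)^k$ on $(0,1)$, $u(0)=-1$, $u(1)=0$ (endpoint values taken as limits). It is known that there is a unique such pair, denoted $(u_{k,n},\lambda_{k,n})$: the first radial $(k,n)$-eigenfunction and eigenvalue. It is also known that $\lambda_{k,n}^k=\inf\frac{E_{k,n}[u]}{I_{k,n}[u]}$, the infimum being over $\alpha$-convex $u$ with $u(1)=0$, $u(0)=-1$, where $E_{k,n}[u]=\frac1{k+1}\int_0^1(-u)S_{k,n}(u)\,r^{n-1}dr$ and $I_{k,n}[u]=\frac1{k+1}\int_0^1(-u)^{k+1}r^{n-1}dr$; the infimum is attained by $u_{k,n}$. *)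

theory Defs
  imports "HOL-Analysis.Analysis"
begin

definition rbinomial :: "real \<Rightarrow> real \<Rightarrow> real" where
  "rbinomial n k = Gamma (n + 1) / (Gamma (k + 1) * Gamma (n - k + 1))"

text \<open>
  Real power of a nonnegative base with the convention \<open>x^0 = 1\<close> also at \<open>x = 0\<close>
  (the library has \<open>0 powr 0 = 0\<close>); this matters for the factor with exponent \<open>k - 1\<close> when \<open>k = 1\<close>.
\<close>
definition rpow :: "real \<Rightarrow> real \<Rightarrow> real" where
  "rpow x a = (if a = 0 then 1 else x powr a)"

definition C2_on :: "real set \<Rightarrow> (real \<Rightarrow> real) \<Rightarrow> bool" where
  "C2_on A u \<longleftrightarrow>
     (\<forall>r\<in>A. u field_differentiable (at r)) \<and>
     (\<forall>r\<in>A. deriv u field_differentiable (at r)) \<and>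
     continuous_on A (deriv (deriv u))"

text \<open>
  Functions on \<open>(0,1)\<close> are represented by total functions; only their values on \<open>(0,1)\<close> are
  used, here and below.
\<close>
definition alpha_convex :: "real \<Rightarrow> (real \<Rightarrow> real) \<Rightarrow> bool" where
  "alpha_convex \<alpha> u \<longleftrightarrow>
     C2_on {0<..<1} u \<and>
     Limsup (at_right 0) (\<lambda>r. ereal (deriv u r / r)) < \<infinity> \<and>
     (\<forall>r\<in>{0<..<1}. deriv u r \<ge> 0 \<and> deriv (deriv u) r + (\<alpha> - 1) * (deriv u r / r) \<ge> 0)"

definition S_op :: "real \<Rightarrow> real \<Rightarrow> (real \<Rightarrow> real) \<Rightarrow> real \<Rightarrow> real" where
  "S_op k n u r =
     rbinomial (n - 1) (k - 1) * rpow (deriv u r / r) (k - 1) *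
     (deriv (deriv u) r + (n - k) / k * (deriv u r / r))"

definition radial_eigenpair :: "real \<Rightarrow> real \<Rightarrow> (real \<Rightarrow> real) \<Rightarrow> real \<Rightarrow> bool" where
  "radial_eigenpair k n u lam \<longleftrightarrow>
     alpha_convex (n / k) u \<and> lam > 0 \<and>
     (\<forall>r\<in>{0<..<1}. S_op k n u r = rpow (- lam * u r) k) \<and>
     (u \<longlongrightarrow> -1) (at_right 0) \<and>
     (u \<longlongrightarrow> 0) (at_left 1)"

text \<open>
  For \<open>1 \<le> k \<le> n\<close> it is known that exactly one number satisfies this predicate;
  the predicate singles out that number without a choice operator.
\<close>
definition first_radial_eigenvalue :: "real \<Rightarrow> real \<Rightarrow> real \<Rightarrow> bool" where
  "first_radial_eigenvalue k n lam \<longleftrightarrow> (\<exists>u. radial_eigenpair k n u lam)"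

end

theory Submission
  imports Defs
begin

text \<open>
  For a radial \<open>(k, \<alpha> k)\<close>-eigenfunction \<open>u\<close> put \<open>f = - u\<close> and \<open>W = r\<^sup>\<alpha>\<^sup>-\<^sup>1 u'\<close>. The equation
  becomes \<open>W\<^sup>k\<^sup>-\<^sup>1 W' = (\<alpha> / r) (c r\<^sup>\<alpha> f)\<^sup>k\<close> with \<open>c = \<lambda> (k B(k, (\<alpha> - 1) k + 1))\<^sup>1\<^sup>/\<^sup>k\<close>. As \<open>f\<close> decreases,
  \<open>W \<ge> c r\<^sup>\<alpha> f\<close>; multiplying the equation by \<open>W\<^sup>l\<^sup>-\<^sup>k\<close> shows that \<open>f\<close> is a supersolution of the problem
  with exponent \<open>l > k\<close> and the same \<open>c\<close>. If \<open>g \<le> C f\<close> for the eigenfunction \<open>- g\<close> with exponent \<open>l\<close>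
  and constant \<open>d\<close>, integrating twice gives \<open>g \<le> C (d / c) f\<close>; iterating this would force \<open>g \<le> 0\<close>
  if \<open>d < c\<close>, so \<open>c \<le> d\<close>. The same inequality applied to the profile \<open>(1 - x)\<^sup>\<alpha>\<^sup>-\<^sup>1\<close> shows that
  \<open>c / \<lambda>\<close> is nonincreasing in \<open>k\<close>.
\<close>

section \<open>Monotonicity from endpoint limits\<close>

text \<open>Stands in for integrating \<open>h'\<close> from the endpoint:
  \<open>h s \<le> h r\<close> for \<open>s\<close> near \<open>a\<close> passes to the limit, so
  neither a value \<open>h a\<close> nor integrability of \<open>h'\<close> enters.\<close>

lemma DERIV_nonneg_tendsto_at_right_imp_le:
  fixes h h' :: "real \<Rightarrow> real"
  assumes "a < r"
    and "\<And>s. a < s \<Longrightarrow> s \<le> r \<Longrightarrow> (h has_real_derivative h' s) (at s)"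
    and "\<And>s. a < s \<Longrightarrow> s \<le> r \<Longrightarrow> 0 \<le> h' s"
    and "(h \<longlongrightarrow> L) (at_right a)"
  shows "L \<le> h r"
proof (rule tendsto_upperbound[OF assms(4)])
  have "eventually (\<lambda>s. s \<in> {a<..<r}) (at_right a)"
    using assms(1) by (rule eventually_at_right_real)
  then show "eventually (\<lambda>s. h s \<le> h r) (at_right a)"
  proof eventually_elim
    case (elim s)
    show ?case
      by (rule deriv_nonneg_imp_mono[where g' = h']) (use elim assms(2,3) in auto)
  qed
qed auto

lemma DERIV_nonpos_tendsto_at_left_imp_ge:
  fixes h h' :: "real \<Rightarrow> real"
  assumes "r < b"
    and "\<And>s. r \<le> s \<Longrightarrow> s < b \<Longrightarrow> (h has_real_derivative h' s) (at s)"
    and "\<And>s. r \<le> s \<Longrightarrow> s < b \<Longrightarrow> h' s \<le> 0"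
    and "(h \<longlongrightarrow> L) (at_left b)"
  shows "L \<le> h r"
proof (rule tendsto_upperbound[OF assms(4)])
  have "eventually (\<lambda>s. s \<in> {r<..<b}) (at_left b)"
    using assms(1) by (rule eventually_at_left_real)
  then show "eventually (\<lambda>s. h s \<le> h r) (at_left b)"
  proof eventually_elim
    case (elim s)
    have "- h r \<le> - h s"
      by (rule deriv_nonneg_imp_mono[where g' = "\<lambda>s. - h' s"]) (use elim assms(2,3) in \<open>auto intro!: DERIV_minus\<close>)
    then show ?case by simp
  qed
qed auto

text \<open>Up to the factor \<open>p\<close>, the two sides of the differential inequality are the
  derivatives of \<open>V powr p\<close> and \<open>W powr p\<close>. The difference of these powers
  is therefore nondecreasing, and it starts from the limit 0.\<close>

lemma powr_flux_mono:
  fixes V V' W W' :: "real \<Rightarrow> real"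
  assumes "0 < p" "0 < r"
    and V: "\<And>s. 0 < s \<Longrightarrow> s \<le> r \<Longrightarrow> (V has_real_derivative V' s) (at s)"
      "\<And>s. 0 < s \<Longrightarrow> s \<le> r \<Longrightarrow> 0 < V s" "(V \<longlongrightarrow> 0) (at_right 0)"
    and W: "\<And>s. 0 < s \<Longrightarrow> s \<le> r \<Longrightarrow> (W has_real_derivative W' s) (at s)"
      "\<And>s. 0 < s \<Longrightarrow> s \<le> r \<Longrightarrow> 0 < W s" "(W \<longlongrightarrow> 0) (at_right 0)"
    and le: "\<And>s. 0 < s \<Longrightarrow> s \<le> r \<Longrightarrow> V s powr (p - 1) * V' s \<le> W s powr (p - 1) * W' s"
  shows "V r \<le> W r"
proof -
  have lim: "((\<lambda>s. X s powr p) \<longlongrightarrow> 0) (at_right 0)"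
    if "(X \<longlongrightarrow> 0) (at_right 0)" "\<And>s. 0 < s \<Longrightarrow> s \<le> r \<Longrightarrow> 0 < X s" for X :: "real \<Rightarrow> real"
  proof -
    have "eventually (\<lambda>s. 0 \<le> X s) (at_right 0)"
      using eventually_at_right_real[OF \<open>0 < r\<close>]
      by eventually_elim (use that(2) in \<open>force intro: less_imp_le\<close>)
    from tendsto_powr'[OF that(1) tendsto_const[of p]] this show ?thesis
      using \<open>0 < p\<close> by simp
  qed
  have "0 \<le> W r powr p - V r powr p"
  proof (rule DERIV_nonneg_tendsto_at_right_imp_le[OF \<open>0 < r\<close>])
    fix s assume s: "0 < s" "s \<le> r"
    show "((\<lambda>s. W s powr p - V s powr p) has_real_derivative
        p * (W s powr (p - 1) * W' s - V s powr (p - 1) * V' s)) (at s)"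
      using DERIV_diff[OF DERIV_fun_powr[OF W(1,2)[OF s], of p] DERIV_fun_powr[OF V(1,2)[OF s], of p]]
      by (simp add: algebra_simps)
    show "0 \<le> p * (W s powr (p - 1) * W' s - V s powr (p - 1) * V' s)"
      using le[OF s] \<open>0 < p\<close> by simp
  next
    show "((\<lambda>s. W s powr p - V s powr p) \<longlongrightarrow> 0) (at_right 0)"
      using tendsto_diff[OF lim[OF W(3,2)] lim[OF V(3,2)]] by simp
  qed
  then show ?thesis
    using powr_less_mono2[OF \<open>0 < p\<close>, of "W r" "V r"] W(2)[of r] \<open>0 < r\<close> by force
qed

section \<open>Power fluxes of decreasing profiles\<close>

text \<open>
  Equivalently, \<open>W r\<close> is \<open>c * r powr \<alpha>\<close> times the mean of order \<open>k\<close> of \<open>f\<close> with respect to the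
  probability measure on \<open>{0..r}\<close> with distribution function \<open>s \<mapsto> (s / r) powr (\<alpha> * k)\<close>.
\<close>
locale power_flux =
  fixes \<alpha> k c :: real and f W W' :: "real \<Rightarrow> real"
  assumes \<alpha>_pos: "0 < \<alpha>" and k_ge_1: "1 \<le> k" and c_pos: "0 < c"
    and f_pos: "0 < r \<Longrightarrow> r < 1 \<Longrightarrow> 0 < f r"
    and f_antimono: "0 < s \<Longrightarrow> s \<le> r \<Longrightarrow> r < 1 \<Longrightarrow> f r \<le> f s"
    and W_pos: "0 < r \<Longrightarrow> r < 1 \<Longrightarrow> 0 < W r"
    and W_deriv: "0 < r \<Longrightarrow> r < 1 \<Longrightarrow> (W has_real_derivative W' r) (at r)"
    and W_eq: "0 < r \<Longrightarrow> r < 1 \<Longrightarrow>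
      W r powr (k - 1) * W' r = \<alpha> / r * (c * r powr \<alpha> * f r) powr k"
    and W_tendsto: "(W \<longlongrightarrow> 0) (at_right 0)"
begin

lemma power_deriv:
  assumes "0 < s"
  shows "((\<lambda>s. d * s powr \<alpha>) has_real_derivative d * (\<alpha> * s powr (\<alpha> - 1))) (at s)"
  using assms by (auto intro!: derivative_eq_intros)

lemma power_flux_eq:
  assumes "0 < s" "0 < d"
  shows "(d * s powr \<alpha>) powr (p - 1) * (d * (\<alpha> * s powr (\<alpha> - 1))) = \<alpha> / s * (d * s powr \<alpha>) powr p"
proof -
  have "(d * s powr \<alpha>) powr p = (d * s powr \<alpha>) powr (p - 1) * (d * s powr \<alpha>)"
    using assms powr_add[of "d * s powr \<alpha>" "p - 1" 1] by simp
  moreover have "s powr (\<alpha> - 1) = s powr \<alpha> / s"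
    using assms by (simp add: powr_diff)
  ultimately show ?thesis by simp
qed

lemma power_tendsto: "((\<lambda>s. d * s powr \<alpha>) \<longlongrightarrow> 0) (at_right (0::real))"
proof -
  have "eventually (\<lambda>s::real. 0 \<le> s) (at_right 0)"
    using eventually_at_right_less by eventually_elim simp
  then have "((\<lambda>s. s powr \<alpha>) \<longlongrightarrow> 0) (at_right (0::real))"
    using \<alpha>_pos tendsto_powr'[of "\<lambda>s. s" 0 "at_right 0" "\<lambda>_. \<alpha>" \<alpha>] by simp
  from tendsto_mult_left[OF this, of d] show ?thesis by simp
qed

lemma W'_nonneg:
  assumes "0 < r" "r < 1"
  shows "0 \<le> W' r"
proof -
  have "0 \<le> W r powr (k - 1) * W' r"
    using W_eq[OF assms] \<alpha>_pos assms by simp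
  then show ?thesis
    using W_pos[OF assms] by (simp add: zero_le_mult_iff)
qed

lemma W_mono:
  assumes "0 < s" "s \<le> r" "r < 1"
  shows "W s \<le> W r"
  by (rule deriv_nonneg_imp_mono[where g' = W']) (use assms W_deriv W'_nonneg in auto)

text \<open>Freeze the profile at its value \<open>f r\<close>, which is its minimum on
  \<open>(0, r]\<close>. The flux of this constant profile is
  \<open>c * f r * s powr \<alpha>\<close>, and it stays below \<open>W\<close>.\<close>

lemma W_ge:
  assumes r: "0 < r" "r < 1"
  shows "c * r powr \<alpha> * f r \<le> W r"
proof -
  have d: "0 < c * f r" using c_pos f_pos r by simp
  have "(c * f r) * r powr \<alpha> \<le> W r"
  proof (rule powr_flux_mono[of k r, OF _ r(1) power_deriv _ power_tendsto W_deriv W_pos W_tendsto])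
    fix s assume s: "0 < s" "s \<le> r"
    have "((c * f r) * s powr \<alpha>) powr k \<le> (c * s powr \<alpha> * f s) powr k"
      using s r d k_ge_1 c_pos f_antimono[OF s r(2)] f_pos[OF r]
      by (intro powr_mono2) (auto simp: mult.commute mult.left_commute intro!: mult_left_mono)
    then show "(c * f r * s powr \<alpha>) powr (k - 1) * (c * f r * (\<alpha> * s powr (\<alpha> - 1)))
        \<le> W s powr (k - 1) * W' s"
      using s r \<alpha>_pos by (subst power_flux_eq) (auto simp: W_eq d intro!: divide_right_mono mult_left_mono)
  qed (use r d k_ge_1 in auto)
  then show ?thesis by (simp add: mult_ac)
qed

text \<open>The opposite comparison, with the constant profile 1 in place of
  \<open>f\<close>.\<close>

lemma W_le:
  assumes f_le: "\<And>s. 0 < s \<Longrightarrow> s < 1 \<Longrightarrow> f s \<le> 1" and r: "0 < r" "r < 1"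
  shows "W r \<le> c * r powr \<alpha>"
proof (rule powr_flux_mono[of k r, OF _ r(1) W_deriv W_pos W_tendsto power_deriv _ power_tendsto])
  fix s assume s: "0 < s" "s \<le> r"
  have "(c * s powr \<alpha> * f s) powr k \<le> (c * s powr \<alpha>) powr k"
    using s r k_ge_1 c_pos f_le[of s] f_pos[of s]
    by (intro powr_mono2) (auto intro!: mult_left_le)
  then show "W s powr (k - 1) * W' s \<le> (c * s powr \<alpha>) powr (k - 1) * (c * (\<alpha> * s powr (\<alpha> - 1)))"
    using s r \<alpha>_pos c_pos
    by (subst power_flux_eq) (auto simp: W_eq intro!: divide_right_mono mult_left_mono)
qed (use r c_pos k_ge_1 in auto)

text \<open>
  Replacing \<open>k - 1\<close> by \<open>l - 1\<close> multiplies the flux equation by \<open>W powr (l - k)\<close>, which is bounded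
  below by \<open>W_ge\<close>; this is the monotonicity of the Lorentz norms \<open>L(1,q)\<close> in \<open>q\<close>.
\<close>
lemma W_super:
  assumes r: "0 < r" "r < 1" and "k \<le> l"
  shows "\<alpha> / r * (c * r powr \<alpha> * f r) powr l \<le> W r powr (l - 1) * W' r"
proof -
  define x where "x = c * r powr \<alpha> * f r"
  have x: "0 < x" "x \<le> W r"
    using W_ge[OF r] c_pos f_pos[OF r] r by (auto simp: x_def)
  have "\<alpha> / r * x powr l = x powr (l - k) * (\<alpha> / r * x powr k)"
    by (simp flip: powr_add)
  also have "\<dots> \<le> W r powr (l - k) * (\<alpha> / r * x powr k)"
    using x r \<alpha>_pos \<open>k \<le> l\<close> by (intro mult_right_mono powr_mono2) auto
  also have "\<dots> = W r powr (l - k) * W r powr (k - 1) * W' r"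
    unfolding x_def W_eq[OF r, symmetric] by (simp only: mult.assoc)
  also have "\<dots> = W r powr (l - 1) * W' r"
    by (simp flip: powr_add)
  finally show ?thesis by (simp add: x_def)
qed

end

text \<open>By \<open>W_super\<close>, \<open>W\<close> is a supersolution for the exponent
  \<open>l\<close>. Scaling it by \<open>q = C * d / c\<close> absorbs both the change of constant
  from \<open>c\<close> to \<open>d\<close> and the factor in \<open>g \<le> C * f\<close>, so
  \<open>q * W\<close> dominates \<open>V\<close>.\<close>

lemma power_flux_le:
  assumes "power_flux \<alpha> k c f W W'" "power_flux \<alpha> l d g V V'" and "k \<le> l"
    and "0 < C" and gf: "\<And>s. 0 < s \<Longrightarrow> s < 1 \<Longrightarrow> g s \<le> C * f s"
    and r: "0 < r" "r < 1"
  shows "V r \<le> C * d / c * W r"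
proof -
  interpret F: power_flux \<alpha> k c f W W' by fact
  interpret G: power_flux \<alpha> l d g V V' by fact
  define q where "q = C * d / c"
  have q: "0 < q" using \<open>0 < C\<close> F.c_pos G.c_pos by (simp add: q_def)
  have "V r \<le> q * W r"
  proof (rule powr_flux_mono[of l r V V' _ "\<lambda>s. q * W' s", OF _ r(1) G.W_deriv G.W_pos G.W_tendsto])
    fix s assume s: "0 < s" "s \<le> r"
    with r have s1: "s < 1" by simp
    have "q * (c * s powr \<alpha> * f s) = d * s powr \<alpha> * (C * f s)"
      using F.c_pos by (simp add: q_def)
    moreover have "d * s powr \<alpha> * g s \<le> d * s powr \<alpha> * (C * f s)"
      using gf[OF s(1) s1] G.c_pos by (intro mult_left_mono) auto
    ultimately have le: "d * s powr \<alpha> * g s \<le> q * (c * s powr \<alpha> * f s)"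
      by (simp only:)
    have "V s powr (l - 1) * V' s \<le> \<alpha> / s * (q * (c * s powr \<alpha> * f s)) powr l"
      using le s F.\<alpha>_pos G.c_pos G.f_pos[OF s(1) s1] G.k_ge_1
      by (auto simp: G.W_eq[OF s(1) s1] intro!: divide_right_mono mult_left_mono powr_mono2)
    also have "\<dots> = q powr l * (\<alpha> / s * (c * s powr \<alpha> * f s) powr l)"
      using q F.c_pos F.f_pos[OF s(1) s1] by (simp add: powr_mult)
    also have "\<dots> \<le> q powr l * (W s powr (l - 1) * W' s)"
      using F.W_super[OF s(1) s1 \<open>k \<le> l\<close>] by (intro mult_left_mono) auto
    also have "\<dots> = (q * W s) powr (l - 1) * (q * W' s)"
      using q F.W_pos[OF s(1) s1] powr_add[of q "l - 1" 1] by (simp add: powr_mult)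
    finally show "V s powr (l - 1) * V' s \<le> (q * W s) powr (l - 1) * (q * W' s)" .
    show "((\<lambda>s. q * W s) has_real_derivative q * W' s) (at s)"
      using F.W_deriv[OF s(1) s1] by (rule DERIV_cmult)
    show "0 < q * W s" using q F.W_pos[OF s(1) s1] by simp
  next
    show "((\<lambda>s. q * W s) \<longlongrightarrow> 0) (at_right 0)"
      using tendsto_mult_left[OF F.W_tendsto, of q] by simp
  qed (use r G.k_ge_1 in auto)
  then show ?thesis by (simp add: q_def)
qed

section \<open>Radial profiles: linear bounds at the boundary and comparison of constants\<close>

locale radial_profile = power_flux +
  assumes \<alpha>_ge_1: "1 \<le> \<alpha>"
    and f_deriv: "0 < r \<Longrightarrow> r < 1 \<Longrightarrow> (f has_real_derivative - (r powr (1 - \<alpha>) * W r)) (at r)"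
    and f_le_1: "0 < r \<Longrightarrow> r < 1 \<Longrightarrow> f r \<le> 1"
    and f_tendsto: "(f \<longlongrightarrow> 0) (at_left 1)"
begin

text \<open>By \<open>W_le\<close> the slope of \<open>f\<close> is at most
  \<open>c * r \<le> c\<close> in absolute value; integrate from the boundary value 0 at 1.\<close>

lemma f_le_linear:
  assumes r: "0 < r" "r < 1"
  shows "f r \<le> c * (1 - r)"
proof -
  have "0 \<le> c * (1 - r) - f r"
  proof (rule DERIV_nonpos_tendsto_at_left_imp_ge[OF r(2)])
    fix s assume s: "r \<le> s" "s < 1"
    then have s0: "0 < s" using r by simp
    show "((\<lambda>s. c * (1 - s) - f s) has_real_derivative s powr (1 - \<alpha>) * W s - c) (at s)"
      using f_deriv[OF s0 s(2)] by (auto intro!: derivative_eq_intros)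
    have "s powr (1 - \<alpha>) * W s \<le> s powr (1 - \<alpha>) * (c * s powr \<alpha>)"
      using W_le[OF f_le_1 s0 s(2)] by (intro mult_left_mono) auto
    also have "\<dots> = c * s"
      using s0 powr_add[of s "1 - \<alpha>" \<alpha>] by simp
    also have "\<dots> \<le> c" using s c_pos by simp
    finally show "s powr (1 - \<alpha>) * W s - c \<le> 0" by simp
  next
    show "((\<lambda>s. c * (1 - s) - f s) \<longlongrightarrow> 0) (at_left 1)"
      using f_tendsto by (auto intro!: tendsto_eq_intros)
  qed
  then show ?thesis by simp
qed

text \<open>A Hopf-type bound. On \<open>[1/2, 1)\<close> the slope of \<open>- f\<close> is at
  least \<open>W (1/2)\<close>, since \<open>W\<close> increases and
  \<open>r powr (1 - \<alpha>) \<ge> 1\<close>. The extra factor 1/2 lets monotonicity of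
  \<open>f\<close> cover \<open>(0, 1/2)\<close>.\<close>

lemma f_ge_linear:
  assumes r: "0 < r" "r < 1"
  shows "W (1/2) / 2 * (1 - r) \<le> f r"
proof -
  have W: "0 < W (1/2)" by (rule W_pos) auto
  have *: "W (1/2) * (1 - t) \<le> f t" if t: "1/2 \<le> t" "t < 1" for t
  proof -
    have "0 \<le> f t - W (1/2) * (1 - t)"
    proof (rule DERIV_nonpos_tendsto_at_left_imp_ge[OF t(2)])
      fix s assume s: "t \<le> s" "s < 1"
      then have s0: "0 < s" using t by simp
      show "((\<lambda>s. f s - W (1/2) * (1 - s)) has_real_derivative W (1/2) - s powr (1 - \<alpha>) * W s) (at s)"
        using f_deriv[OF s0 s(2)] by (auto intro!: derivative_eq_intros)
      have "1 \<le> s powr (1 - \<alpha>)"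
        using powr_mono'[of "1 - \<alpha>" 0 s] s0 s \<alpha>_ge_1 by simp
      then have "1 * W (1/2) \<le> s powr (1 - \<alpha>) * W s"
        using W_mono[of "1/2" s] s t W by (intro mult_mono) auto
      then show "W (1/2) - s powr (1 - \<alpha>) * W s \<le> 0" by simp
    next
      show "((\<lambda>s. f s - W (1/2) * (1 - s)) \<longlongrightarrow> 0) (at_left 1)"
        using f_tendsto by (auto intro!: tendsto_eq_intros)
    qed
    then show ?thesis by simp
  qed
  show ?thesis
  proof (cases "1/2 \<le> r")
    case True
    have "W (1/2) / 2 * (1 - r) \<le> W (1/2) * (1 - r)"
      using W r by (intro mult_right_mono) auto
    with *[OF True r(2)] show ?thesis by (rule order_trans[rotated])
  next
    case False
    have "W (1/2) / 2 * (1 - r) \<le> W (1/2) / 2 * 1"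
      using W r by (intro mult_left_mono) auto
    moreover have "f (1/2) \<le> f r" using False r by (intro f_antimono) auto
    ultimately show ?thesis using *[of "1/2"] by simp
  qed
qed

end

text \<open>The flux comparison \<open>V \<le> q * W\<close> is a comparison of slopes, integrated
  here from the common boundary value 0 at 1. It is the improvement step of an iteration:
  \<open>C\<close> becomes \<open>C * d / c\<close>.\<close>

lemma radial_profile_le:
  assumes "radial_profile \<alpha> k c f W W'" "radial_profile \<alpha> l d g V V'" and "k \<le> l"
    and "0 < C" and gf: "\<And>s. 0 < s \<Longrightarrow> s < 1 \<Longrightarrow> g s \<le> C * f s"
    and r: "0 < r" "r < 1"
  shows "g r \<le> C * d / c * f r"
proof -
  interpret F: radial_profile \<alpha> k c f W W' by fact
  interpret G: radial_profile \<alpha> l d g V V' by fact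
  define q where "q = C * d / c"
  have "0 \<le> q * f r - g r"
  proof (rule DERIV_nonpos_tendsto_at_left_imp_ge[OF r(2)])
    fix s assume s: "r \<le> s" "s < 1"
    then have s0: "0 < s" using r by simp
    show "((\<lambda>s. q * f s - g s) has_real_derivative s powr (1 - \<alpha>) * (V s - q * W s)) (at s)"
      using F.f_deriv[OF s0 s(2)] G.f_deriv[OF s0 s(2)]
      by (auto intro!: derivative_eq_intros simp: algebra_simps)
    have "V s \<le> q * W s"
      unfolding q_def
      by (rule power_flux_le[OF F.power_flux_axioms G.power_flux_axioms \<open>k \<le> l\<close> \<open>0 < C\<close> gf s0 s(2)])
    then show "s powr (1 - \<alpha>) * (V s - q * W s) \<le> 0"
      by (intro mult_nonneg_nonpos) auto
  next
    show "((\<lambda>s. q * f s - g s) \<longlongrightarrow> 0) (at_left 1)"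
      using F.f_tendsto G.f_tendsto by (auto intro!: tendsto_eq_intros)
  qed
  then show ?thesis by (simp add: q_def)
qed

text \<open>If \<open>d < c\<close>, every use of \<open>radial_profile_le\<close> gains the factor
  \<open>d / c < 1\<close>, so \<open>g\<close> would be squeezed to 0. The linear bounds at the
  boundary provide the first constant \<open>C\<close>.\<close>

lemma radial_profile_constant_mono:
  assumes F: "radial_profile \<alpha> k c f W W'" and G: "radial_profile \<alpha> l d g V V'" and "k \<le> l"
  shows "c \<le> d"
proof (rule ccontr)
  assume "\<not> c \<le> d"
  interpret F: radial_profile \<alpha> k c f W W' by fact
  interpret G: radial_profile \<alpha> l d g V V' by fact
  define q where "q = d / c"
  have q: "0 < q" "q < 1"
    using \<open>\<not> c \<le> d\<close> F.c_pos G.c_pos by (auto simp: q_def)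
  \<comment> \<open>The ratio of the upper slope \<open>d\<close> for \<open>g\<close> to the lower
    slope \<open>W (1/2) / 2\<close> for \<open>f\<close>.\<close>
  define C where "C = 2 * d / W (1/2)"
  have W: "0 < W (1/2)" by (rule F.W_pos) auto
  have C: "0 < C" using W G.c_pos by (simp add: C_def)
  have *: "\<forall>r. 0 < r \<and> r < 1 \<longrightarrow> g r \<le> C * q ^ n * f r" for n
  proof (induction n)
    case 0
    show ?case
    proof (intro allI impI)
      fix r :: real assume r: "0 < r \<and> r < 1"
      have "g r \<le> d * (1 - r)" using G.f_le_linear r by blast
      also have "\<dots> = C * (W (1/2) / 2 * (1 - r))" using W by (simp add: C_def)
      also have "\<dots> \<le> C * f r" using F.f_ge_linear r C by (intro mult_left_mono) auto
      finally show "g r \<le> C * q ^ 0 * f r" by simp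
    qed
  next
    case (Suc n)
    show ?case
      using radial_profile_le[OF F G \<open>k \<le> l\<close>, of "C * q ^ n"] C q Suc
      by (auto simp: q_def mult_ac)
  qed
  have "(\<lambda>n. C * q ^ n * f (1/2)) \<longlonglongrightarrow> C * 0 * f (1/2)"
    using q by (intro tendsto_intros LIMSEQ_power_zero) auto
  then have "g (1/2) \<le> 0"
    using * by (intro tendsto_lowerbound[where F = sequentially and a = "g (1/2)"]) auto
  then show False using G.f_pos[of "1/2"] by simp
qed

section \<open>The normalising constant\<close>

text \<open>For \<open>\<alpha> \<ge> 1\<close> and \<open>k \<ge> 1\<close> its power of order
  \<open>k\<close> is the reciprocal of \<open>\<alpha>\<close> times the binomial coefficient in
  \<open>S_op k (\<alpha> * k)\<close>, so it moves that coefficient into the constant of the flux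
  equation.\<close>

definition profile_const :: "real \<Rightarrow> real \<Rightarrow> real" where
  "profile_const \<alpha> k = (k * Beta k ((\<alpha> - 1) * k + 1)) powr (1 / k)"

text \<open>Both sides are the same Gamma quotient once \<open>Gamma (\<alpha> * k + 1) = \<alpha> *
  k * Gamma (\<alpha> * k)\<close> is used.\<close>

lemma rbinomial_eq_Beta:
  assumes "1 \<le> \<alpha>" "1 \<le> k"
  shows "\<alpha> * rbinomial (\<alpha> * k - 1) (k - 1) = 1 / (k * Beta k ((\<alpha> - 1) * k + 1))"
proof -
  have pos: "0 < \<alpha> * k" using assms by simp
  have "\<alpha> * k \<notin> \<int>\<^sub>\<le>\<^sub>0" using pos by (auto elim!: nonpos_Ints_cases)
  then have "Gamma (\<alpha> * k + 1) = \<alpha> * k * Gamma (\<alpha> * k)" by (rule Gamma_plus1)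
  moreover have e: "\<alpha> * k - 1 - (k - 1) + 1 = (\<alpha> - 1) * k + 1"
      "k + ((\<alpha> - 1) * k + 1) = \<alpha> * k + 1"
    by (simp_all add: algebra_simps)
  ultimately show ?thesis
    unfolding rbinomial_def Beta_def e using assms by simp
qed

text \<open>
  The constant is the mean of order \<open>k\<close> of the decreasing profile \<open>(1 - x) powr (\<alpha> - 1)\<close>, so the
  Lorentz monotonicity applies to it as well.
\<close>
lemma power_flux_Beta:
  fixes \<alpha> k :: real
  assumes "1 \<le> \<alpha>" "1 \<le> k"
  defines "h \<equiv> \<lambda>x. k * (x powr (k - 1) * (1 - x) powr ((\<alpha> - 1) * k))"
  defines "W \<equiv> \<lambda>x. integral {0..x} h powr (1 / k)"
  shows "\<exists>W'. power_flux 1 k 1 (\<lambda>x. (1 - x) powr (\<alpha> - 1)) W W'"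
    and "(W \<longlongrightarrow> profile_const \<alpha> k) (at_left 1)"
proof -
  define F where "F = (\<lambda>x. integral {0..x} h)"
  have "(h has_integral k * Beta k ((\<alpha> - 1) * k + 1)) {0..1}"
    unfolding h_def using has_integral_mult_right[OF has_integral_Beta_real[of k "(\<alpha> - 1) * k + 1"], of k] assms(1,2)
    by (simp add: add_nonneg_pos)
  then have h: "h integrable_on {0..1}" and F1: "F 1 = k * Beta k ((\<alpha> - 1) * k + 1)"
    by (auto simp: F_def)
  have cont: "continuous_on {0..1} F"
    unfolding F_def by (rule indefinite_integral_continuous_1[OF h])
  have F': "(F has_real_derivative h x) (at x)" if x: "0 < x" "x < 1" for x
  proof -
    have "isCont h x"
      unfolding h_def using x by (intro continuous_intros) auto
    then have "(F has_vector_derivative h x) (at x within {0..1})"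
      using integral_has_vector_derivative_continuous_at[OF h, of x "{}"] x
      by (auto simp: F_def intro: continuous_at_imp_continuous_at_within)
    moreover have "at x within {0..1} = at x"
      using x by (intro at_within_interior) auto
    ultimately show ?thesis
      by (simp add: has_real_derivative_iff_has_vector_derivative)
  qed
  have F_pos: "0 < F x" if x: "0 < x" "x < 1" for x
  proof -
    have "F 0 < F x"
    proof (rule DERIV_pos_imp_increasing_open[OF x(1)], intro exI conjI)
      fix y assume "0 < y" "y < x"
      then show "(F has_real_derivative h y) (at y)" "0 < h y"
        using x F' assms(2) by (auto simp: h_def)
    next
      show "continuous_on {0..x} F" using x by (auto intro: continuous_on_subset[OF cont])
    qed
    then show ?thesis by (simp add: F_def)
  qed
  define W' where "W' = (\<lambda>x. 1 / k * F x powr (1 / k - 1) * h x)"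
  have W: "W = (\<lambda>x. F x powr (1 / k))" by (simp add: W_def F_def)
  have "power_flux 1 k 1 (\<lambda>x. (1 - x) powr (\<alpha> - 1)) W W'"
  proof
    fix r :: real assume r: "0 < r" "r < 1"
    show "(W has_real_derivative W' r) (at r)"
      using DERIV_fun_powr[OF F'[OF r] F_pos[OF r], of "1 / k"] by (simp add: W W'_def)
    show "0 < W r" using F_pos[OF r] by (simp add: W)
    \<comment> \<open>Since \<open>W powr k = F\<close> and \<open>F\<close> has derivative
      \<open>h\<close>, the powers of \<open>F\<close> in \<open>W powr (k - 1) * W'\<close> must
      cancel, leaving \<open>h / k\<close>.\<close>
    have "(1 / k) * (k - 1) + (1 / k - 1) = 0"
      using assms(2) by (simp add: field_simps)
    then have "F r powr (1 / k * (k - 1)) * F r powr (1 / k - 1) = 1"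
      using F_pos[OF r] by (simp flip: powr_add)
    then have "W r powr (k - 1) * W' r = h r / k"
      by (simp add: W W'_def powr_powr mult.assoc[symmetric])
    also have "\<dots> = 1 / r * (1 * r powr 1 * (1 - r) powr (\<alpha> - 1)) powr k"
      using r assms(2) powr_diff[of r k 1] powr_mult[of r "(1 - r) powr (\<alpha> - 1)" k]
      by (simp add: h_def powr_powr)
    finally show "W r powr (k - 1) * W' r = 1 / r * (1 * r powr 1 * (1 - r) powr (\<alpha> - 1)) powr k" .
  next
    have "(F \<longlongrightarrow> 0) (at_right 0)"
      using cont by (auto simp: continuous_on_Icc_at_rightD F_def dest: continuous_on_Icc_at_rightD)
    moreover have "eventually (\<lambda>x. 0 \<le> F x) (at_right 0)"
      using eventually_at_right_real[OF zero_less_one] by eventually_elim (simp add: F_pos less_imp_le)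
    ultimately show "(W \<longlongrightarrow> 0) (at_right 0)"
      using tendsto_powr'[of F 0 "at_right 0" "\<lambda>_. 1 / k" "1 / k"] assms(2) by (simp add: W)
  qed (use assms in \<open>auto intro!: powr_mono2\<close>)
  then show "\<exists>W'. power_flux 1 k 1 (\<lambda>x. (1 - x) powr (\<alpha> - 1)) W W'" by blast
  have "0 < F 1"
    using assms by (simp add: F1 Beta_def Gamma_real_pos add_nonneg_pos add_pos_nonneg)
  moreover have "(F \<longlongrightarrow> F 1) (at_left 1)"
    using cont by (auto dest: continuous_on_Icc_at_leftD)
  ultimately have "((\<lambda>x. F x powr (1 / k)) \<longlongrightarrow> F 1 powr (1 / k)) (at_left 1)"
    by (intro tendsto_powr tendsto_const) auto
  then show "(W \<longlongrightarrow> profile_const \<alpha> k) (at_left 1)"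
    by (simp add: W profile_const_def F1)
qed

text \<open>Both fluxes have the same profile and constant 1, so \<open>power_flux_le\<close>
  applies with \<open>C = 1\<close>; then let \<open>x\<close> tend to 1.\<close>

lemma profile_const_antimono:
  assumes "1 \<le> \<alpha>" "1 \<le> k" "k \<le> l"
  shows "profile_const \<alpha> l \<le> profile_const \<alpha> k"
proof -
  have l: "1 \<le> l" using assms by simp
  obtain W' V' where WV: 
    "power_flux 1 k 1 (\<lambda>x. (1 - x) powr (\<alpha> - 1))
       (\<lambda>x. integral {0..x} (\<lambda>x. k * (x powr (k - 1) * (1 - x) powr ((\<alpha> - 1) * k))) powr (1 / k)) W'"
    "power_flux 1 l 1 (\<lambda>x. (1 - x) powr (\<alpha> - 1))
       (\<lambda>x. integral {0..x} (\<lambda>x. l * (x powr (l - 1) * (1 - x) powr ((\<alpha> - 1) * l))) powr (1 / l)) V'"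
    using power_flux_Beta(1)[OF assms(1,2)] power_flux_Beta(1)[OF assms(1) l] by blast
  show ?thesis
  proof (rule tendsto_le[OF _ power_flux_Beta(2)[OF assms(1,2)] power_flux_Beta(2)[OF assms(1) l]])
    show "eventually (\<lambda>x. integral {0..x} (\<lambda>x. l * (x powr (l - 1) * (1 - x) powr ((\<alpha> - 1) * l))) powr (1 / l)
      \<le> integral {0..x} (\<lambda>x. k * (x powr (k - 1) * (1 - x) powr ((\<alpha> - 1) * k))) powr (1 / k)) (at_left 1)"
      using eventually_at_left_real[OF zero_less_one]
    proof eventually_elim
      case (elim x)
      then show ?case
        using power_flux_le[OF WV assms(3), of 1 x] by simp
    qed
  qed simp
qed

section \<open>Eigenfunctions as radial profiles\<close>

text \<open>Multiplying the equation by \<open>r powr (\<alpha> * k - 1)\<close> gives the flux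
  equation. Strict signs of \<open>u\<close> and \<open>u'\<close> have to be derived first, as the
  definition gives only \<open>u' \<ge> 0\<close>.\<close>

lemma radial_eigenpair_imp_radial_profile:
  assumes "1 \<le> \<alpha>" "1 \<le> k" and eig: "radial_eigenpair k (\<alpha> * k) u lam"
  shows "\<exists>W W'. radial_profile \<alpha> k (lam * profile_const \<alpha> k) (\<lambda>r. - u r) W W'"
proof -
  define u' where "u' = deriv u"
  define u'' where "u'' = deriv u'"
  define b where "b = rbinomial (\<alpha> * k - 1) (k - 1)"
  define c where "c = lam * profile_const \<alpha> k"
  define W where "W = (\<lambda>r. r powr (\<alpha> - 1) * u' r)"
  define W' where "W' = (\<lambda>r. r powr (\<alpha> - 1) * (u'' r + (\<alpha> - 1) * (u' r / r)))"
  have k: "k > 0" using assms by simp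
  note eig' = eig[unfolded radial_eigenpair_def alpha_convex_def C2_on_def]
  have lam: "lam > 0" and u0: "(u \<longlongrightarrow> -1) (at_right 0)" and u1: "(u \<longlongrightarrow> 0) (at_left 1)"
    using eig' by auto
  have du: "(u has_real_derivative u' r) (at r)" and du': "(u' has_real_derivative u'' r) (at r)"
    and u'_nonneg: "0 \<le> u' r" and lap_nonneg: "0 \<le> u'' r + (\<alpha> - 1) * (u' r / r)"
    if "0 < r" "r < 1" for r
    using eig' that k unfolding u'_def u''_def
    by (auto simp: DERIV_deriv_iff_field_differentiable)
  have eq: "b * rpow (u' r / r) (k - 1) * (u'' r + (\<alpha> - 1) * (u' r / r)) = (lam * - u r) powr k"
    if "0 < r" "r < 1" for r
  proof -
    have "(\<alpha> * k - k) / k = \<alpha> - 1" using k by (simp add: field_simps)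
    moreover have "S_op k (\<alpha> * k) u r = rpow (- lam * u r) k"
      using eig' that by auto
    ultimately show ?thesis
      using k by (simp add: S_op_def u'_def u''_def b_def rpow_def)
  qed
  have W_deriv: "(W has_real_derivative W' r) (at r)" if r: "0 < r" "r < 1" for r
  proof -
    have "(W has_real_derivative (\<alpha> - 1) * r powr (\<alpha> - 1 - 1) * u' r + u'' r * r powr (\<alpha> - 1)) (at r)"
      unfolding W_def by (rule DERIV_mult[OF has_real_derivative_powr[OF r(1)] du'[OF r]])
    moreover have "r powr (\<alpha> - 1 - 1) = r powr (\<alpha> - 1) / r"
      using r powr_diff[of r "\<alpha> - 1" 1] by simp
    ultimately show ?thesis by (simp add: W'_def algebra_simps diff_divide_distrib)
  qed
  have W_mono: "W s \<le> W r" if "0 < s" "s \<le> r" "r < 1" for s r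
    by (rule deriv_nonneg_imp_mono[where g' = W'])
       (use that W_deriv lap_nonneg in \<open>auto simp: W'_def\<close>)
  have u_le: "-1 \<le> u r" "u r \<le> 0" if r: "0 < r" "r < 1" for r
  proof -
    show "-1 \<le> u r"
      by (rule DERIV_nonneg_tendsto_at_right_imp_le[OF r(1) du _ u0]) (use r u'_nonneg in auto)
    have "0 \<le> - u r"
      by (rule DERIV_nonpos_tendsto_at_left_imp_ge[OF r(2), where h' = "\<lambda>s. - u' s"])
         (use r u'_nonneg du tendsto_minus[OF u1] in \<open>auto intro!: DERIV_minus\<close>)
    then show "u r \<le> 0" by simp
  qed
  \<comment> \<open>A zero of \<open>u'\<close> at \<open>r\<close> makes the nonnegative,
    nondecreasing \<open>W\<close> vanish on \<open>(0, r]\<close>. Then \<open>u\<close> stays at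
    most -1 there and the right side of the equation is positive, while the left side
    vanishes.\<close>
  have u'_pos: "0 < u' r" if r: "0 < r" "r < 1" for r
  proof (rule ccontr)
    assume "\<not> 0 < u' r"
    then have "u' r = 0" using u'_nonneg[OF r] by simp
    have zero: "u' s = 0" if s: "0 < s" "s \<le> r" for s
    proof -
      have "W s \<le> 0" using W_mono[OF s r(2)] \<open>u' r = 0\<close> by (simp add: W_def)
      then show ?thesis
        using u'_nonneg[of s] s r by (simp add: W_def mult_le_0_iff)
    qed
    define s where "s = r / 2"
    have s: "0 < s" "s < r" "s < 1" using r by (auto simp: s_def)
    have "- 1 \<ge> u s"
    proof -
      have "1 \<le> - u s"
      proof (rule DERIV_nonneg_tendsto_at_right_imp_le[OF s(1)])
        show "((\<lambda>x. - u x) \<longlongrightarrow> 1) (at_right 0)" using tendsto_minus[OF u0] by simp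
        fix x assume "0 < x" "x \<le> s"
        then show "((\<lambda>x. - u x) has_real_derivative - u' x) (at x)" "0 \<le> - u' x"
          using s zero[of x] du[of x] DERIV_minus[of u "u' x" x] by auto
      qed
      then show ?thesis by simp
    qed
    \<comment> \<open>Needed for \<open>k = 1\<close>, where \<open>rpow\<close> is 1 even at base 0
      and the second-order factor must vanish instead. The point \<open>s\<close> lies inside
      \<open>(0, r)\<close>, so \<open>u'\<close> is zero near it.\<close>
    have "u'' s = 0"
    proof -
      have "(u' has_real_derivative 0) (at s)"
      proof (rule has_field_derivative_transform_within_open[OF DERIV_const[of 0]])
        show "s \<in> {0<..<r}" using s by simp
      qed (use zero in auto)
      then show ?thesis using du'[OF s(1,3)] DERIV_unique by blast
    qed
    then have "(lam * - u s) powr k = 0"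
      using eq[OF s(1,3)] zero[of s] s by simp
    then show False using lam \<open>- 1 \<ge> u s\<close> by simp
  qed
  have W_pos: "0 < W r" if "0 < r" "r < 1" for r
    using u'_pos[OF that] that by (simp add: W_def)
  have u_neg: "u r < 0" if r: "0 < r" "r < 1" for r
  proof -
    define s where "s = (r + 1) / 2"
    have s: "r < s" "s < 1" using r by (auto simp: s_def)
    have "u r < u s"
    proof (rule DERIV_pos_imp_increasing[OF s(1)], intro exI conjI)
      fix x assume "r \<le> x" "x \<le> s"
      then show "(u has_real_derivative u' x) (at x)" "0 < u' x"
        using r s du u'_pos by auto
    qed
    then show ?thesis using u_le(2)[of s] s r by simp
  qed
  define B where "B = k * Beta k ((\<alpha> - 1) * k + 1)"
  have B_pos: "0 < B"
    using assms(1,2) by (simp add: B_def Beta_def Gamma_real_pos add_nonneg_pos add_pos_nonneg)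
  have b: "\<alpha> * b = 1 / B"
    unfolding b_def B_def by (rule rbinomial_eq_Beta[OF assms(1,2)])
  have c: "c = lam * B powr (1 / k)"
    by (simp add: c_def profile_const_def B_def)
  have ck: "c powr k * (\<alpha> * b) = lam powr k"
    using lam k B_pos by (simp add: c b powr_mult powr_powr)
  have b_pos: "0 < b"
    using b B_pos assms(1) by (metis divide_pos_pos zero_less_one order_less_le_trans zero_less_mult_pos)
  have c_pos: "0 < c"
    using lam B_pos by (simp add: c)
  have W_eq: "W r powr (k - 1) * W' r = \<alpha> / r * (c * r powr \<alpha> * - u r) powr k"
    if r: "0 < r" "r < 1" for r
  proof -
    define L where "L = u'' r + (\<alpha> - 1) * (u' r / r)"
    \<comment> \<open>In this variable \<open>W r = r powr \<alpha> * x\<close>, which separates the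
      powers of \<open>r\<close> from the equation for \<open>x\<close> and
      \<open>L\<close>.\<close>
    define x where "x = u' r / r"
    have x: "0 < x" using u'_pos[OF r] r by (simp add: x_def)
    have ux: "u' r = r * x" using r by (simp add: x_def)
    have "rpow x (k - 1) = x powr (k - 1)"
      using x by (simp add: rpow_def)
    moreover have "(lam * - u r) powr k = lam powr k * (- u r) powr k"
      by (rule powr_mult)
    ultimately have e: "b * (x powr (k - 1) * L) = lam powr k * (- u r) powr k"
      using eq[OF r] by (simp only: x_def L_def mult.assoc)
    have "W r = r powr \<alpha> * x"
      using r by (simp add: W_def ux powr_diff)
    then have "W r powr (k - 1) * W' r = r powr (\<alpha> * (k - 1)) * r powr (\<alpha> - 1) * (x powr (k - 1) * L)"
      using r x by (simp add: W'_def L_def powr_mult powr_powr)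
    also have "r powr (\<alpha> * (k - 1)) * r powr (\<alpha> - 1) = r powr (\<alpha> * k) / r"
      using r powr_diff[of r "\<alpha> * k" 1] by (simp flip: powr_add add: algebra_simps)
    also have "x powr (k - 1) * L = \<alpha> * (c powr k * (- u r) powr k)"
      using e b_pos by (simp flip: ck add: field_simps)
    also have "r powr (\<alpha> * k) / r * (\<alpha> * (c powr k * (- u r) powr k)) = \<alpha> / r * (c * r powr \<alpha> * - u r) powr k"
      using r c_pos u_neg[OF r] powr_mult[of "c * r powr \<alpha>" "- u r" k]
      by (simp add: powr_mult powr_powr)
    finally show ?thesis .
  qed
  \<comment> \<open>The \<open>Limsup\<close> condition gives \<open>u' r \<le> M * r\<close> near
    0, and \<open>r powr (\<alpha> - 1) \<le> 1\<close>, so \<open>W\<close> is squeezed between 0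
    and \<open>M * r\<close>.\<close>
  have W_lim: "(W \<longlongrightarrow> 0) (at_right 0)"
  proof -
    have "Limsup (at_right 0) (\<lambda>r. ereal (u' r / r)) < \<infinity>"
      using eig' by (simp add: u'_def)
    then obtain M where "Limsup (at_right 0) (\<lambda>r. ereal (u' r / r)) < ereal M"
      using less_PInf_Ex_of_nat by auto
    then have "eventually (\<lambda>r. ereal (u' r / r) < ereal M) (at_right 0)"
      by (rule Limsup_lessD)
    moreover have "eventually (\<lambda>r. r \<in> {0<..<1}) (at_right (0::real))"
      by (rule eventually_at_right_real) simp
    ultimately have "eventually (\<lambda>r. 0 \<le> W r \<and> W r \<le> M * r) (at_right 0)"
    proof eventually_elim
      case (elim r)
      have "r powr (\<alpha> - 1) \<le> 1"
        using elim assms(1) powr_le1[of "\<alpha> - 1" r] by simp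
      then have "W r \<le> 1 * u' r"
        unfolding W_def using elim u'_nonneg[of r] by (intro mult_right_mono) auto
      also have "\<dots> \<le> M * r" using elim by (simp add: field_simps)
      finally show ?case using W_pos[of r] elim by simp
    qed
    moreover have "((\<lambda>r. M * r) \<longlongrightarrow> 0) (at_right 0)"
      by (auto intro!: tendsto_eq_intros)
    ultimately show ?thesis
      by (intro tendsto_sandwich[of "\<lambda>_. 0" W _ "\<lambda>r. M * r" 0]) (auto elim: eventually_mono)
  qed
  have "radial_profile \<alpha> k c (\<lambda>r. - u r) W W'"
  proof
    fix r s :: real assume "0 < s" "s \<le> r" "r < 1"
    then have "u s \<le> u r"
      by (intro deriv_nonneg_imp_mono[where g = u and g' = u']) (use du u'_nonneg in auto)
    then show "- u r \<le> - u s" by simp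
  next
    fix r :: real assume r: "0 < r" "r < 1"
    have "r powr (1 - \<alpha>) * W r = u' r"
      using r powr_add[of r "1 - \<alpha>" "\<alpha> - 1"] by (simp add: W_def)
    then show "((\<lambda>r. - u r) has_real_derivative - (r powr (1 - \<alpha>) * W r)) (at r)"
      using du[OF r] by (auto intro!: DERIV_minus)
  next
    show "((\<lambda>r. - u r) \<longlongrightarrow> 0) (at_left 1)" using tendsto_minus[OF u1] by simp
  qed (use assms(1,2) c_pos u_neg u_le W_pos W_deriv W_eq W_lim in \<open>auto simp: minus_le_iff\<close>)
  then show ?thesis unfolding c_def by blast
qed

theorem corollary1p4:
  fixes \<alpha> k l lam_k lam_l :: real
  assumes "\<alpha> \<ge> 1" and "1 \<le> k" and "k < l"
    and "first_radial_eigenvalue k (\<alpha> * k) lam_k"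
    and "first_radial_eigenvalue l (\<alpha> * l) lam_l"
  shows "lam_k \<le> lam_l"
proof -
  obtain u v where uv: "radial_eigenpair k (\<alpha> * k) u lam_k" "radial_eigenpair l (\<alpha> * l) v lam_l"
    using assms(4,5) by (auto simp: first_radial_eigenvalue_def)
  obtain W W' where F: "radial_profile \<alpha> k (lam_k * profile_const \<alpha> k) (\<lambda>r. - u r) W W'"
    using radial_eigenpair_imp_radial_profile[OF assms(1,2) uv(1)] by blast
  obtain V V' where G: "radial_profile \<alpha> l (lam_l * profile_const \<alpha> l) (\<lambda>r. - v r) V V'"
    using radial_eigenpair_imp_radial_profile[OF assms(1) _ uv(2)] assms(2,3) by auto
  interpret F: radial_profile \<alpha> k "lam_k * profile_const \<alpha> k" "\<lambda>r. - u r" W W' by fact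
  have lam: "0 < lam_k" "0 < lam_l"
    using uv by (auto simp: radial_eigenpair_def)
  have "lam_k * profile_const \<alpha> k \<le> lam_l * profile_const \<alpha> l"
    using radial_profile_constant_mono[OF F G] assms(3) by simp
  also have "\<dots> \<le> lam_l * profile_const \<alpha> k"
    using profile_const_antimono[OF assms(1,2)] assms(3) lam by simp
  \<comment> \<open>Positivity of \<open>lam_k * profile_const \<alpha> k\<close> makes the common
    factor positive, so it cancels.\<close>
  finally show ?thesis
    using F.c_pos lam by (simp add: zero_less_mult_iff)
qed

end
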